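(* Let $h,b>0$, $\rho=b/(h+b)$, and consider the newsvendor cost $c(x,d)=h(x-d)^++b(d-x)^+$. For a demand CDF $F$ on $[0,\infty)$ let $C_F(x)=\mathbb{E}_{D\sim F}[c(x,D)]$, $x^*_F=\arg\min_{x\ge0}C_F(x)$, and $\bar D_F=\sup\{x:F(x)<1\}$. Let $\mathcal F_\alpha$ be the class of demand CDFs $F$ with $\bar D_F<\infty$ that are differentiable with $F'(x)\ge\alpha$ for all $x\in[0,\bar D_F]$. An admissible policy $\pi=(\pi_1,\pi_2,\dots)$ is a sequence of (possibly randomized) maps, $\pi_t$ mapping the history $(d_1,\dots,d_t)$ of i.i.d. demand samples from $F$ to an order quantity $x_t^\pi$; let $\Pi$ be the set of admissible policies and $\mathcal R^\pi(F,T)=\sum_{t=1}^T\mathbb{E}[C_F(x_t^\pi)-C_F(x_F^* )]$. Then for any $\alpha\le\min\{1/2,2\rho,2(1-\rho)\}$ and any $T\ge\max\{\alpha^{-3},64\}$, $$\inf_{\pi\in\Pi}\sup_{F\in\mathcal F_\alpha}\mathcal R^\pi(F,T)\ge K_6\cdot\frac{\ln T}{\alpha},\qquad K_6=\min\left\{\frac{\rho(1-\rho)}{4\pi^2},\frac{1}{400\pi^2}\right\}\cdot\frac{h+b}{12}.$$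
   Context: Data-driven repeated newsvendor problem with linear overage cost $h$ and underage cost $b$; the expectation in the regret is over the demand samples and the randomness of the policy. Here $\alpha>0$. *)

theory Defs
  imports "HOL-Probability.Probability"
begin

definition nv_cost :: "real \<Rightarrow> real \<Rightarrow> real \<Rightarrow> real \<Rightarrow> real" where
  "nv_cost h b x d = h * max (x - d) 0 + b * max (d - x) 0"

definition exp_cost :: "real \<Rightarrow> real \<Rightarrow> real measure \<Rightarrow> real \<Rightarrow> real" where
  "exp_cost h b M x = (\<integral>d. nv_cost h b x d \<partial>M)"

definition opt_cost :: "real \<Rightarrow> real \<Rightarrow> real measure \<Rightarrow> real" where
  "opt_cost h b M = Inf (exp_cost h b M ` {0..})"

definition Dbar :: "real measure \<Rightarrow> real" where
  "Dbar M = Sup {x. cdf M x < 1}"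

definition demand_class :: "real \<Rightarrow> real measure set" where
  "demand_class \<alpha> = {M. prob_space M \<and> sets M = sets borel \<and>
      measure M {..<0} = 0 \<and>
      (\<exists>B. \<forall>x. cdf M x < 1 \<longrightarrow> x \<le> B) \<and>
      0 < Dbar M \<and>
      (\<forall>x\<in>{0..Dbar M}. \<exists>D. (cdf M has_real_derivative D) (at x within {0..Dbar M}) \<and> \<alpha> \<le> D)}"

text \<open>Admissible (possibly randomized) policy: a random seed u drawn from the probability
  space R, and at time t the order quantity pol t u d depends on the seed and the
  samples d 0, ..., d (t-1) (i.e. d_1..d_t).\<close>
definition admissible :: "'u measure \<Rightarrow> (nat \<Rightarrow> 'u \<Rightarrow> (nat \<Rightarrow> real) \<Rightarrow> real) \<Rightarrow> bool" where
  "admissible R pol \<longleftrightarrow> prob_space R \<and>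
     (\<forall>t. (\<lambda>(u, d). pol t u d) \<in> borel_measurable (R \<Otimes>\<^sub>M PiM {..<t} (\<lambda>_. borel))) \<and>
     (\<forall>t u d. 0 \<le> pol t u d)"

definition regret :: "real \<Rightarrow> real \<Rightarrow> real measure \<Rightarrow> 'u measure \<Rightarrow>
    (nat \<Rightarrow> 'u \<Rightarrow> (nat \<Rightarrow> real) \<Rightarrow> real) \<Rightarrow> nat \<Rightarrow> ennreal" where
  "regret h b M R pol T = (\<Sum>t\<in>{1..T}.
      \<integral>\<^sup>+ ud. ennreal (exp_cost h b M (pol t (fst ud) (snd ud)) - opt_cost h b M)
        \<partial>(R \<Otimes>\<^sub>M PiM {..<t} (\<lambda>_. M)))"

end

theory Submission
  imports Defs
begin

text \<open>
  The demand laws \<open>F\<close> have an atom of mass \<open>\<rho> - \<alpha> * \<theta>\<close> at \<open>0\<close> (differentiability on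
  \<open>[0, 1/4]\<close> is one-sided at \<open>0\<close>, so the class admits it), density exactly \<open>\<alpha>\<close> on \<open>(0, 1/8]\<close>,
  and a tail on \<open>[1/8, 1/4]\<close> absorbing the remaining mass. Then \<open>F x = \<rho> + \<alpha> * (x - \<theta>)\<close> on
  \<open>[0, 1/8]\<close>, the optimal order is \<open>\<theta>\<close>, and missing it by \<open>z\<close> costs
  \<open>(h + b) * \<alpha> / 2 * z\<^sup>2\<close>. Two parameters at distance \<open>\<eta>\<close> differ only by moving the mass
  \<open>\<alpha> * \<eta>\<close> from the atom to the tail, so they are hard to tell apart from \<open>t\<close> samples when
  \<open>\<eta> \<le> sqrt (\<rho> * (1 - \<rho>) / t) / (2 * \<alpha>)\<close>; this costs a multiple of
  \<open>(h + b) * \<rho> * (1 - \<rho>) / (\<alpha> * t)\<close> in period \<open>t\<close>. A single uniform prior on a fine grid of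
  parameters gives this bound simultaneously for all \<open>t\<close> between \<open>T powr (2/3)\<close> and \<open>T\<close>, by
  pairing grid points at a distance adapted to \<open>t\<close>. Summing \<open>1 / t\<close> over this range yields
  \<open>ln T / 3\<close>.
\<close>

section \<open>Convexity of the newsvendor cost\<close>

text \<open>The cost is convex and piecewise linear in the order; the factor of \<open>x - y\<close>
  is its right slope at \<open>y\<close>, namely \<open>h\<close> if \<open>d \<le> y\<close> and
  \<open>-b\<close> otherwise.\<close>

lemma nv_cost_subgradient:
  assumes "0 \<le> h" "0 \<le> b"
  shows "nv_cost h b y d + ((h + b) * indicator {..y} d - b) * (x - y) \<le> nv_cost h b x d"
proof (cases "d \<le> y")
  case True
  have "h * (x - d) \<le> h * max (x - d) 0" using assms by (intro mult_left_mono) auto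
  moreover have "0 \<le> b * max (d - x) 0" using assms by simp
  ultimately show ?thesis using True by (simp add: nv_cost_def max_def algebra_simps)
next
  case False
  have "b * (d - x) \<le> b * max (d - x) 0" using assms by (intro mult_left_mono) auto
  moreover have "0 \<le> h * max (x - d) 0" using assms by simp
  ultimately show ?thesis using False by (simp add: nv_cost_def max_def algebra_simps)
qed

lemma integrable_nv_cost:
  assumes "prob_space M" "sets M = sets borel" "integrable M (\<lambda>d. d)"
  shows "integrable M (nv_cost h b x)"
proof -
  interpret prob_space M by fact
  note [measurable_cong] = assms(2)
  show ?thesis
    unfolding nv_cost_def[abs_def]
    by (intro Bochner_Integration.integrable_add integrable_mult_right integrable_max
        Bochner_Integration.integrable_diff assms(3)) auto
qed

text \<open>Integrating the pointwise supporting lines turns the indicator into the distribution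
  function.\<close>

lemma exp_cost_subgradient:
  assumes "0 \<le> h" "0 \<le> b"
  assumes M: "prob_space M" "sets M = sets borel" "integrable M (\<lambda>d. d)"
  shows "exp_cost h b M y + ((h + b) * cdf M y - b) * (x - y) \<le> exp_cost h b M x"
proof -
  interpret prob_space M by fact
  note [measurable_cong] = M(2)
  note int [simp, intro] = integrable_nv_cost[OF M]
  have 1: "integrable M (indicator {..y} :: real \<Rightarrow> real)"
    by (simp add: emeasure_eq_measure)
  have 2: "integrable M (\<lambda>d. ((h + b) * indicator {..y} d - b) * (x - y))"
    using 1 by auto
  have "exp_cost h b M y + ((h + b) * cdf M y - b) * (x - y)
      = (\<integral>d. nv_cost h b y d + ((h + b) * indicator {..y} d - b) * (x - y) \<partial>M)"
    using 1 2 by (simp add: exp_cost_def cdf_def prob_space)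
  also have "\<dots> \<le> exp_cost h b M x"
    unfolding exp_cost_def
    by (intro integral_mono Bochner_Integration.integrable_add int 2 nv_cost_subgradient assms)
  finally show ?thesis .
qed

text \<open>A Riemann sum of subgradient inequalities stands in for integrating a derivative of the
  cost. Keeping the factor \<open>x - y\<close> on both sides of the growth hypothesis treats
  \<open>x\<close> above and below \<open>y\<close> at once.\<close>

lemma exp_cost_quadratic_growth:
  assumes "0 < h" "0 < b"
  assumes M: "prob_space M" "sets M = sets borel" "integrable M (\<lambda>d. d)"
  assumes growth: "\<And>z. z \<in> closed_segment y x \<Longrightarrow>
    \<alpha> * (z - y) * (x - y) \<le> (cdf M z - b / (h + b)) * (x - y)"
  shows "(h + b) * \<alpha> / 2 * (x - y)\<^sup>2 \<le> exp_cost h b M x - exp_cost h b M y"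
proof -
  define C where "C = exp_cost h b M"
  define K where "K = (h + b) * \<alpha> / 2 * (x - y)\<^sup>2"
  have hb: "h + b > 0" using assms by simp
  have sub: "C z + (h + b) * (cdf M z - b / (h + b)) * (w - z) \<le> C w" for z w
  proof -
    have "(h + b) * (cdf M z - b / (h + b)) = (h + b) * cdf M z - b"
      using hb by (simp add: right_diff_distrib)
    then show ?thesis
      using exp_cost_subgradient[of h b M z w] assms by (simp add: C_def)
  qed
  have bound: "K - K / real n \<le> C x - C y" if n: "n > 0" for n :: nat
  proof -
    define z where "z j = y + real j / real n * (x - y)" for j
    have step: "2 * K * (real j / (real n)\<^sup>2) \<le> C (z (Suc j)) - C (z j)" if "j \<le> n" for j
    proof -
      have "z j \<in> closed_segment y x"
        unfolding closed_segment_def z_def using that n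
        by (auto intro!: exI[of _ "real j / real n"] simp: algebra_simps diff_divide_distrib)
      from growth[OF this]
      have "\<alpha> * (real j / real n * (x - y)) * (x - y) \<le> (cdf M (z j) - b / (h + b)) * (x - y)"
        by (simp add: z_def)
      from mult_left_mono[OF this, of "(h + b) / real n"]
      have "(h + b) / real n * (\<alpha> * (real j / real n * (x - y)) * (x - y))
          \<le> (h + b) / real n * ((cdf M (z j) - b / (h + b)) * (x - y))"
        using hb by simp
      also have "(h + b) / real n * (\<alpha> * (real j / real n * (x - y)) * (x - y))
          = 2 * K * (real j / (real n)\<^sup>2)"
        by (simp add: K_def power2_eq_square)
      also have "(h + b) / real n * ((cdf M (z j) - b / (h + b)) * (x - y))
          = (h + b) * (cdf M (z j) - b / (h + b)) * ((x - y) / real n)"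
        by simp
      finally have "2 * K * (real j / (real n)\<^sup>2)
          \<le> (h + b) * (cdf M (z j) - b / (h + b)) * ((x - y) / real n)" .
      also have "(x - y) / real n = z (Suc j) - z j"
        by (simp add: z_def add_divide_distrib diff_divide_distrib algebra_simps)
      also have "(h + b) * (cdf M (z j) - b / (h + b)) * (z (Suc j) - z j) \<le> C (z (Suc j)) - C (z j)"
        using sub[of "z j" "z (Suc j)"] by simp
      finally show ?thesis .
    qed
    \<comment> \<open>The increments add up by 2 (0 + 1 + ... + (j - 1)) = j (j - 1). At
      \<open>j = n\<close> the left endpoints lose only \<open>K / n\<close>, which vanishes in the
      limit.\<close>
    have "K * (real j * (real j - 1) / (real n)\<^sup>2) \<le> C (z j) - C (z 0)" if "j \<le> n" for j
      using that
    proof (induction j)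
      case (Suc j)
      have "K * (real (Suc j) * (real (Suc j) - 1) / (real n)\<^sup>2)
          = K * (real j * (real j - 1) / (real n)\<^sup>2) + 2 * K * (real j / (real n)\<^sup>2)"
        by (simp add: add_divide_distrib diff_divide_distrib algebra_simps)
      then show ?case using Suc step[of j] by simp
    qed simp
    from this[of n] have "K * ((real n - 1) / real n) \<le> C x - C y"
      using n by (simp add: z_def power2_eq_square)
    then show ?thesis using n by (simp add: diff_divide_distrib right_diff_distrib)
  qed
  have "K \<le> C x - C y"
  proof (rule tendsto_upperbound)
    show "(\<lambda>n. K - K / real n) \<longlonglongrightarrow> K"
      using tendsto_diff[OF tendsto_const lim_const_over_n, of K K] by simp
    show "\<forall>\<^sub>F n in sequentially. C x - C y \<ge> K - K / real n"
      using eventually_gt_at_top[of 0] by eventually_elim (rule bound)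
  qed simp
  then show ?thesis by (simp add: K_def C_def)
qed

section \<open>Two-point testing bound\<close>

text \<open>The two measures agree on measurable rectangles, because the integral of a product of
  one-coordinate functions factorizes.\<close>

lemma density_PiM:
  fixes f :: "'a \<Rightarrow> ennreal"
  assumes "finite I" "prob_space M" "prob_space (density M f)"
    and [measurable]: "f \<in> borel_measurable M"
  shows "PiM I (\<lambda>_. density M f) = density (PiM I (\<lambda>_. M)) (\<lambda>x. \<Prod>i\<in>I. f (x i))"
proof -
  interpret M: prob_space M by fact
  interpret D: prob_space "density M f" by fact
  interpret PM: product_sigma_finite "\<lambda>_. M" by standard
  interpret PD: product_sigma_finite "\<lambda>_. density M f" by standard
  show ?thesis
  proof (rule PD.PiM_eqI[OF \<open>finite I\<close>, symmetric])
    show "sets (density (PiM I (\<lambda>_. M)) (\<lambda>x. \<Prod>i\<in>I. f (x i))) = sets (PiM I (\<lambda>_. density M f))"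
      by (simp cong: sets_PiM_cong)
  next
    fix A assume "\<And>i. i \<in> I \<Longrightarrow> A i \<in> sets (density M f)"
    then have A: "\<And>i. i \<in> I \<Longrightarrow> A i \<in> sets M" by simp
    have [measurable]: "Pi\<^sub>E I A \<in> sets (PiM I (\<lambda>_. M))"
      using A \<open>finite I\<close> by (intro sets_PiM_I_finite) auto
    have "emeasure (density (PiM I (\<lambda>_. M)) (\<lambda>x. \<Prod>i\<in>I. f (x i))) (Pi\<^sub>E I A)
        = (\<integral>\<^sup>+ x. (\<Prod>i\<in>I. f (x i)) * indicator (Pi\<^sub>E I A) x \<partial>PiM I (\<lambda>_. M))"
      by (rule emeasure_density) auto
    also have "\<dots> = (\<integral>\<^sup>+ x. (\<Prod>i\<in>I. f (x i) * indicator (A i) (x i)) \<partial>PiM I (\<lambda>_. M))"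
    proof (rule nn_integral_cong)
      fix x assume "x \<in> space (PiM I (\<lambda>_. M))"
      then have "indicator (Pi\<^sub>E I A) x = (\<Prod>i\<in>I. indicator (A i) (x i) :: ennreal)"
        using \<open>finite I\<close> by (auto simp: space_PiM indicator_def PiE_def Pi_def)
      then show "(\<Prod>i\<in>I. f (x i)) * indicator (Pi\<^sub>E I A) x = (\<Prod>i\<in>I. f (x i) * indicator (A i) (x i))"
        by (simp add: prod.distrib)
    qed
    also have "\<dots> = (\<Prod>i\<in>I. \<integral>\<^sup>+ y. f y * indicator (A i) y \<partial>M)"
      using A \<open>finite I\<close> by (intro PM.product_nn_integral_prod) auto
    also have "\<dots> = (\<Prod>i\<in>I. emeasure (density M f) (A i))"
      using A by (intro prod.cong refl) (simp add: emeasure_density)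
    finally show "emeasure (density (PiM I (\<lambda>_. M)) (\<lambda>x. \<Prod>i\<in>I. f (x i))) (Pi\<^sub>E I A)
        = (\<Prod>i\<in>I. emeasure (density M f) (A i))" .
  qed
qed

text \<open>Le Cam's two-point bound, with the affinity estimated through
  \<open>min 1 r \<ge> r - r\<^sup>2 / 4\<close> by the second moment of the likelihood ratio.\<close>
lemma two_point_bound:
  fixes r v w :: "'a \<Rightarrow> real"
  assumes Q: "prob_space (density P r)"
    and [measurable]: "r \<in> borel_measurable P" "v \<in> borel_measurable P" "w \<in> borel_measurable P"
    and nonneg: "\<And>x. 0 \<le> r x" "\<And>x. 0 \<le> v x" "\<And>x. 0 \<le> w x"
    and sep: "\<And>x. c \<le> v x + w x" and "0 \<le> c" "0 \<le> B"
    and second: "(\<integral>\<^sup>+ x. ennreal ((r x)\<^sup>2) \<partial>P) \<le> ennreal B"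
  shows "ennreal (c * (1 - B / 4)) \<le> (\<integral>\<^sup>+ x. v x \<partial>P) + (\<integral>\<^sup>+ x. w x \<partial>density P r)"
proof -
  \<comment> \<open>If \<open>r x \<le> 1\<close>, the separation is weighted by \<open>r x\<close>;
    otherwise it is used unweighted together with r - r^2/4 \<le> 1, which is (r/2 - 1)^2 \<ge>
    0.\<close>
  have pt: "c * r x \<le> v x + r x * w x + c / 4 * (r x)\<^sup>2" for x
  proof -
    have "c * (r x - (r x)\<^sup>2 / 4) \<le> v x + r x * w x"
    proof (cases "r x \<le> 1")
      case True
      have "c * r x \<le> (v x + w x) * r x" using sep nonneg by (intro mult_right_mono) auto
      also have "(v x + w x) * r x \<le> v x + r x * w x"
        using True nonneg mult_right_mono[of "r x" 1 "v x"] by (simp add: algebra_simps)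
      finally have "c * r x \<le> v x + r x * w x" .
      moreover have "0 \<le> c * (r x)\<^sup>2" using \<open>0 \<le> c\<close> by simp
      ultimately show ?thesis by (simp add: right_diff_distrib)
    next
      case False
      have "r x - (r x)\<^sup>2 / 4 \<le> 1"
        using zero_le_power2[of "r x / 2 - 1"] by (simp add: power2_eq_square algebra_simps)
      then have "c * (r x - (r x)\<^sup>2 / 4) \<le> c * 1" using \<open>0 \<le> c\<close> by (rule mult_left_mono)
      also have "\<dots> \<le> v x + w x" using sep by simp
      also have "\<dots> \<le> v x + r x * w x"
        using False nonneg mult_right_mono[of 1 "r x" "w x"] by simp
      finally show ?thesis .
    qed
    then show ?thesis by (simp add: algebra_simps)
  qed
  have "(\<integral>\<^sup>+ x. ennreal (r x) \<partial>P) = 1"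
    using prob_space.emeasure_space_1[OF Q] by (simp add: emeasure_density cong: nn_integral_cong)
  then have "ennreal c = (\<integral>\<^sup>+ x. ennreal (c * r x) \<partial>P)"
    using \<open>0 \<le> c\<close> nonneg by (simp add: ennreal_mult nn_integral_cmult)
  also have "\<dots> \<le> (\<integral>\<^sup>+ x. ennreal (v x) + ennreal (r x) * ennreal (w x)
      + ennreal (c / 4) * ennreal ((r x)\<^sup>2) \<partial>P)"
    using pt nonneg \<open>0 \<le> c\<close>
    by (intro nn_integral_mono)
      (auto simp: ennreal_mult[symmetric] ennreal_plus[symmetric] simp del: ennreal_plus intro!: ennreal_leI)
  also have "\<dots> = (\<integral>\<^sup>+ x. v x \<partial>P) + (\<integral>\<^sup>+ x. w x \<partial>density P r)
      + ennreal (c / 4) * (\<integral>\<^sup>+ x. ennreal ((r x)\<^sup>2) \<partial>P)"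
    by (simp add: nn_integral_add nn_integral_density nn_integral_cmult)
  also have "\<dots> \<le> (\<integral>\<^sup>+ x. v x \<partial>P) + (\<integral>\<^sup>+ x. w x \<partial>density P r) + ennreal (c / 4) * ennreal B"
    by (intro add_left_mono mult_left_mono second) auto
  also have "ennreal (c / 4) * ennreal B = ennreal (c * B / 4)"
    using \<open>0 \<le> c\<close> \<open>0 \<le> B\<close> by (simp add: ennreal_mult[symmetric])
  finally have "ennreal c - ennreal (c * B / 4) \<le> (\<integral>\<^sup>+ x. v x \<partial>P) + (\<integral>\<^sup>+ x. w x \<partial>density P r)"
    by (simp add: ennreal_minus_le_iff add.commute)
  then show ?thesis
    using \<open>0 \<le> c\<close> \<open>0 \<le> B\<close> by (simp add: ennreal_minus algebra_simps)
qed

text \<open>The seed has law \<open>R\<close> under both hypotheses, so the joint likelihood ratio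
  is the product of \<open>r\<close> over the samples; by independence its second moment is at most
  \<open>B ^ t\<close>.\<close>

lemma two_point_bound_samples:
  fixes r :: "'b \<Rightarrow> real"
  assumes R: "prob_space R" and M: "prob_space M" and Q: "prob_space (density M r)"
    and [measurable]: "r \<in> borel_measurable M"
    and r: "\<And>x. 0 \<le> r x" "(\<integral>\<^sup>+ x. ennreal ((r x)\<^sup>2) \<partial>M) \<le> ennreal B"
    and [measurable]: "v \<in> borel_measurable (R \<Otimes>\<^sub>M PiM {..<t} (\<lambda>_. M))"
      "w \<in> borel_measurable (R \<Otimes>\<^sub>M PiM {..<t} (\<lambda>_. M))"
    and vw: "\<And>x. 0 \<le> v x" "\<And>x. 0 \<le> w x" "\<And>x. c \<le> v x + w x" and "0 \<le> c" "0 \<le> B"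
  shows "ennreal (c * (1 - B ^ t / 4)) \<le> (\<integral>\<^sup>+ x. v x \<partial>(R \<Otimes>\<^sub>M PiM {..<t} (\<lambda>_. M)))
    + (\<integral>\<^sup>+ x. w x \<partial>(R \<Otimes>\<^sub>M PiM {..<t} (\<lambda>_. density M r)))"
proof -
  interpret R: prob_space R by fact
  interpret M: prob_space M by fact
  interpret Q: prob_space "density M r" by fact
  interpret PM: product_sigma_finite "\<lambda>_. M" by standard
  interpret PMp: prob_space "PiM {..<t} (\<lambda>_. M)" by (intro prob_space_PiM M)
  interpret PQp: prob_space "PiM {..<t} (\<lambda>_. density M r)" by (intro prob_space_PiM Q)
  interpret RP: pair_prob_space R "PiM {..<t} (\<lambda>_. M)" ..
  interpret RQ: pair_prob_space R "PiM {..<t} (\<lambda>_. density M r)" ..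
  let ?L = "\<lambda>x. \<Prod>i<t. r (x i)"
  have PQ: "PiM {..<t} (\<lambda>_. density M r) = density (PiM {..<t} (\<lambda>_. M)) (\<lambda>x. ennreal (?L x))"
    by (subst density_PiM) (auto simp: prod_ennreal r M Q)
  have "density R (\<lambda>_. 1) \<Otimes>\<^sub>M density (PiM {..<t} (\<lambda>_. M)) (\<lambda>x. ennreal (?L x))
      = density (R \<Otimes>\<^sub>M PiM {..<t} (\<lambda>_. M)) (\<lambda>(u, x). 1 * ennreal (?L x))"
    using PQp.sigma_finite_measure_axioms PQ
    by (intro pair_measure_density) (auto intro: PMp.sigma_finite_measure_axioms)
  then have RPQ: "R \<Otimes>\<^sub>M PiM {..<t} (\<lambda>_. density M r)
      = density (R \<Otimes>\<^sub>M PiM {..<t} (\<lambda>_. M)) (\<lambda>x. ennreal (?L (snd x)))"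
    by (simp add: PQ density_1 split_beta')
  have "(\<integral>\<^sup>+ x. ennreal ((?L (snd x))\<^sup>2) \<partial>(R \<Otimes>\<^sub>M PiM {..<t} (\<lambda>_. M)))
      = (\<integral>\<^sup>+ x. ennreal ((?L x)\<^sup>2) \<partial>PiM {..<t} (\<lambda>_. M))"
    by (subst PMp.nn_integral_fst[symmetric]) (auto simp: R.emeasure_space_1)
  also have "\<dots> = (\<integral>\<^sup>+ x. (\<Prod>i<t. ennreal ((r (x i))\<^sup>2)) \<partial>PiM {..<t} (\<lambda>_. M))"
    by (simp add: prod_ennreal prod_power_distrib)
  also have "\<dots> = (\<integral>\<^sup>+ x. ennreal ((r x)\<^sup>2) \<partial>M) ^ t"
    by (subst PM.product_nn_integral_prod) auto
  also have "\<dots> \<le> ennreal B ^ t" by (intro power_mono r) auto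
  also have "\<dots> = ennreal (B ^ t)" using \<open>0 \<le> B\<close> by (simp add: ennreal_power)
  finally have sec: "(\<integral>\<^sup>+ x. ennreal ((?L (snd x))\<^sup>2) \<partial>(R \<Otimes>\<^sub>M PiM {..<t} (\<lambda>_. M))) \<le> ennreal (B ^ t)" .
  show ?thesis
    unfolding RPQ
  proof (rule two_point_bound)
    show "prob_space (density (R \<Otimes>\<^sub>M PiM {..<t} (\<lambda>_. M)) (\<lambda>x. ennreal (?L (snd x))))"
      using RQ.prob_space_axioms unfolding RPQ .
  qed (use sec vw \<open>0 \<le> c\<close> \<open>0 \<le> B\<close> in \<open>auto intro!: prod_nonneg r\<close>)
qed

section \<open>A one-parameter family of demand laws\<close>

text \<open>Squaring smooths the hinge: at the kink the difference quotient is bounded by the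
  distance to \<open>a\<close>. This makes the distribution functions of the family differentiable
  across 1/8.\<close>

lemma DERIV_max_0_squared:
  fixes a x :: real
  shows "((\<lambda>x. (max (x - a) 0)\<^sup>2) has_real_derivative 2 * max (x - a) 0) (at x)"
proof -
  consider "x < a" | "x = a" | "a < x" by linarith
  then show ?thesis
  proof cases
    case 1
    have "((\<lambda>x. (max (x - a) 0)\<^sup>2) has_real_derivative 0) (at x)"
      by (rule has_field_derivative_transform_within_open[of "\<lambda>_. 0" 0 x "{..<a}"]) (use 1 in auto)
    then show ?thesis using 1 by simp
  next
    case 2
    have "((\<lambda>y. ((max (y - a) 0)\<^sup>2 - (max (a - a) 0)\<^sup>2) / (y - a)) \<longlongrightarrow> 0) (at a)"
    proof (rule Lim_null_comparison)
      show "((\<lambda>y. \<bar>y - a\<bar>) \<longlongrightarrow> 0) (at a)"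
        by (auto intro!: tendsto_eq_intros)
      show "\<forall>\<^sub>F y in at a. norm (((max (y - a) 0)\<^sup>2 - (max (a - a) 0)\<^sup>2) / (y - a)) \<le> \<bar>y - a\<bar>"
        by (auto simp: max_def power2_eq_square)
    qed
    then show ?thesis using 2 by (simp add: has_field_derivative_iff)
  next
    case 3
    have "((\<lambda>x. (max (x - a) 0)\<^sup>2) has_real_derivative 2 * (x - a)) (at x)"
      by (rule has_field_derivative_transform_within_open[of "\<lambda>x. (x - a)\<^sup>2" _ x "{a<..}"])
        (use 3 in \<open>auto intro!: derivative_eq_intros\<close>)
    then show ?thesis using 3 by simp
  qed
qed

text \<open>Pushing \<open>[-1, 1/4]\<close> forward along \<open>max 0\<close> gives Lebesgue measure on \<open>[0, 1/4]\<close> plus a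
  unit atom at \<open>0\<close>.\<close>
definition base_measure :: "real measure" where
  "base_measure = distr (density lborel (indicator {-1..1/4})) borel (\<lambda>x. max x 0)"

lemma sets_base_measure [simp, measurable_cong]: "sets base_measure = sets borel"
  by (simp add: base_measure_def)

lemma space_base_measure [simp]: "space base_measure = UNIV"
  by (simp add: base_measure_def)

lemma nn_integral_base_measure:
  assumes [measurable]: "g \<in> borel_measurable borel"
  shows "(\<integral>\<^sup>+ x. g x \<partial>base_measure) = g 0 + (\<integral>\<^sup>+ x. g x * indicator {0..1/4} x \<partial>lborel)"
proof -
  have "(\<integral>\<^sup>+ x. g x \<partial>base_measure) = (\<integral>\<^sup>+ x. indicator {-1..1/4} x * g (max x 0) \<partial>lborel)"
    unfolding base_measure_def by (subst nn_integral_distr) (auto simp: nn_integral_density)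
  also have "\<dots> = (\<integral>\<^sup>+ x. g 0 * indicator {-1..<0} x + g x * indicator {0..1/4} x \<partial>lborel)"
    by (intro nn_integral_cong) (auto simp: indicator_def max_def)
  also have "\<dots> = g 0 + (\<integral>\<^sup>+ x. g x * indicator {0..1/4} x \<partial>lborel)"
    by (subst nn_integral_add) (auto simp: nn_integral_cmult)
  finally show ?thesis .
qed

lemma AE_base_measure: "AE x in base_measure. x \<in> {0..1/4}"
  unfolding base_measure_def
  by (subst AE_distr_iff) (auto simp: AE_density indicator_def)

text \<open>Since 64 (1/8)^2 = 1, the coefficient \<open>c\<close> is exactly the mass that the
  hinge density puts on [1/8, 1/4].\<close>

lemma DERIV_affine_hinge:
  "((\<lambda>x. k + a * x + 64 * c * (max (x - 1/8) 0)\<^sup>2)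
    has_real_derivative a + 128 * c * max (x - 1/8) 0) (at x)"
  by (rule DERIV_cong[OF DERIV_add[OF DERIV_add[OF DERIV_const DERIV_cmult_Id]
        DERIV_cmult[OF DERIV_max_0_squared]]]) simp

lemma nn_integral_affine_hinge:
  assumes "0 \<le> a" "0 \<le> c" "0 \<le> z"
  shows "(\<integral>\<^sup>+ x. ennreal (a + 128 * c * max (x - 1/8) 0) * indicator {0..z} x \<partial>lborel)
    = ennreal (a * z + 64 * c * (max (z - 1/8) 0)\<^sup>2)"
proof -
  have "(\<integral>\<^sup>+ x. ennreal (a + 128 * c * max (x - 1/8) 0) * indicator {0..z} x \<partial>lborel)
      = (0 + a * z + 64 * c * (max (z - 1/8) 0)\<^sup>2) - (0 + a * 0 + 64 * c * (max (0 - 1/8) 0)\<^sup>2)"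
    by (rule nn_integral_FTC_Icc[OF _ DERIV_affine_hinge]) (use assms in auto)
  then show ?thesis by simp
qed

text \<open>\<rho> plays the critical ratio \<open>b / (h + b)\<close>. The bounds on \<alpha> leave
  the atom at least half of \<rho> and the tail at least half of 1 - \<rho>, uniformly for
  parameters in [0, 1/8].\<close>

locale demand_family =
  fixes \<alpha> \<rho> :: real
  assumes pos: "0 < \<alpha>" and le_left: "\<alpha> \<le> 2 * \<rho>" and le_right: "\<alpha> \<le> 2 * (1 - \<rho>)"
begin

definition atom :: "real \<Rightarrow> real" where
  "atom \<theta> = \<rho> - \<alpha> * \<theta>"

text \<open>What remains of the unit mass after the atom and the mass \<alpha>/4 of the constant
  density on [0, 1/4].\<close>

definition tail :: "real \<Rightarrow> real" where
  "tail \<theta> = 1 - \<rho> - \<alpha> * (1/4 - \<theta>)"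

text \<open>The tail density has its kink at \<open>1/8\<close>, so that the distribution function is differentiable
  and equals \<open>\<rho> + \<alpha> * (x - \<theta>)\<close> on \<open>[0, 1/8]\<close>: the parameter is the optimal order quantity.\<close>
definition dens :: "real \<Rightarrow> real \<Rightarrow> real" where
  "dens \<theta> x = (if x \<le> 0 then atom \<theta> else \<alpha> + 128 * tail \<theta> * max (x - 1/8) 0)"

definition demand :: "real \<Rightarrow> real measure" where
  "demand \<theta> = density base_measure (\<lambda>x. ennreal (dens \<theta> x))"

lemma rho: "0 < \<rho>" "\<rho> < 1"
  using pos le_left le_right by auto

lemma dens_measurable [measurable]: "dens \<theta> \<in> borel_measurable borel"
  unfolding dens_def[abs_def] by measurable

lemma sets_demand [simp, measurable_cong]: "sets (demand \<theta>) = sets borel"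
  by (simp add: demand_def)

lemma space_demand [simp]: "space (demand \<theta>) = UNIV"
  by (simp add: demand_def)

lemma AE_demand: "AE x in demand \<theta>. x \<in> {0..1/4}"
  unfolding demand_def using AE_base_measure by (auto simp: AE_density)

context
  fixes \<theta> :: real
  assumes \<theta>: "\<theta> \<in> {0..1/8}"
begin

lemma atom_ge: "\<rho> / 2 \<le> atom \<theta>"
proof -
  have "\<alpha> * \<theta> \<le> \<alpha> * (1/8)" using \<theta> pos by (intro mult_left_mono) auto
  then show ?thesis using le_left rho by (simp add: atom_def)
qed

lemma tail_ge: "(1 - \<rho>) / 2 \<le> tail \<theta>"
proof -
  have "\<alpha> * (1/4 - \<theta>) \<le> \<alpha> * (1/4)" using \<theta> pos by (intro mult_left_mono) auto
  then show ?thesis using le_right by (simp add: tail_def)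
qed

lemma atom_pos: "0 < atom \<theta>" and tail_pos: "0 < tail \<theta>"
  using atom_ge tail_ge rho by auto

lemma dens_pos: "0 < dens \<theta> x"
  using atom_pos tail_pos pos by (auto simp: dens_def intro!: add_pos_nonneg)

section \<open>Distribution function and membership in the class\<close>

lemma emeasure_demand_atMost:
  assumes "z \<in> {0..1/4}"
  shows "emeasure (demand \<theta>) {..z} = ennreal (atom \<theta> + \<alpha> * z + 64 * tail \<theta> * (max (z - 1/8) 0)\<^sup>2)"
proof -
  have "emeasure (demand \<theta>) {..z} = (\<integral>\<^sup>+ x. ennreal (dens \<theta> x) * indicator {..z} x \<partial>base_measure)"
    unfolding demand_def by (subst emeasure_density) auto
  also have "\<dots> = ennreal (atom \<theta>)
      + (\<integral>\<^sup>+ x. ennreal (dens \<theta> x) * indicator {..z} x * indicator {0..1/4} x \<partial>lborel)"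
    using assms by (subst nn_integral_base_measure) (auto simp: dens_def)
  also have "(\<integral>\<^sup>+ x. ennreal (dens \<theta> x) * indicator {..z} x * indicator {0..1/4} x \<partial>lborel)
      = (\<integral>\<^sup>+ x. ennreal (\<alpha> + 128 * tail \<theta> * max (x - 1/8) 0) * indicator {0..z} x \<partial>lborel)"
  \<comment> \<open>At 0 the value of \<open>dens\<close> is the mass of the atom, not a Lebesgue
    density; that single point is null.\<close>
  proof (rule nn_integral_cong_AE)
    show "AE x in lborel. ennreal (dens \<theta> x) * indicator {..z} x * indicator {0..1/4} x
        = ennreal (\<alpha> + 128 * tail \<theta> * max (x - 1/8) 0) * indicator {0..z} x"
      using AE_lborel_singleton[of 0]
      by eventually_elim (use assms in \<open>auto simp: dens_def indicator_def\<close>)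
  qed
  also have "\<dots> = ennreal (\<alpha> * z + 64 * tail \<theta> * (max (z - 1/8) 0)\<^sup>2)"
    using assms pos tail_pos by (intro nn_integral_affine_hinge) auto
  also have "ennreal (atom \<theta>) + \<dots> = ennreal (atom \<theta> + (\<alpha> * z + 64 * tail \<theta> * (max (z - 1/8) 0)\<^sup>2))"
    using atom_pos tail_pos pos assms by (intro ennreal_plus[symmetric]) auto
  finally show ?thesis by (simp only: add.assoc)
qed

lemma prob_space_demand: "prob_space (demand \<theta>)"
proof
  have "emeasure (demand \<theta>) (space (demand \<theta>)) = emeasure (demand \<theta>) {..1/4}"
    by (rule emeasure_eq_AE) (use AE_demand in auto)
  also have "\<dots> = 1"
    by (subst emeasure_demand_atMost) (auto simp: atom_def tail_def power2_eq_square algebra_simps)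
  finally show "emeasure (demand \<theta>) (space (demand \<theta>)) = 1" .
qed

lemma cdf_demand:
  assumes "z \<in> {0..1/4}"
  shows "cdf (demand \<theta>) z = atom \<theta> + \<alpha> * z + 64 * tail \<theta> * (max (z - 1/8) 0)\<^sup>2"
  using emeasure_demand_atMost[OF assms] assms atom_pos tail_pos pos
  by (simp add: cdf_def measure_def del: ennreal_plus)

lemma cdf_demand_left:
  assumes "z \<in> {0..1/8}"
  shows "cdf (demand \<theta>) z = \<rho> + \<alpha> * (z - \<theta>)"
  using assms by (subst cdf_demand) (auto simp: atom_def algebra_simps)

lemma cdf_demand_less_1_iff: "cdf (demand \<theta>) x < 1 \<longleftrightarrow> x < 1/4"
proof -
  interpret prob_space "demand \<theta>" by (rule prob_space_demand)
  have mono: "cdf (demand \<theta>) y \<le> cdf (demand \<theta>) z" if "y \<le> z" for y z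
    unfolding cdf_def using that by (intro finite_measure_mono) auto
  have one: "cdf (demand \<theta>) (1/4) = 1"
    by (subst cdf_demand) (auto simp: atom_def tail_def power2_eq_square algebra_simps)
  show ?thesis
  proof
    assume "cdf (demand \<theta>) x < 1"
    then show "x < 1/4" using mono[of "1/4" x] one by linarith
  next
    assume x: "x < 1/4"
    \<comment> \<open>Truncation at 0 moves the argument into the range where the formula for
      \<open>cdf\<close> holds; strictness then comes from the term
      \<open>\<alpha> * y\<close>.\<close>
    define y where "y = max x 0"
    have y: "y \<in> {0..1/4}" "y < 1/4" "x \<le> y" using x by (auto simp: y_def)
    have "(max (y - 1/8) 0)\<^sup>2 \<le> (max (1/4 - 1/8) 0 :: real)\<^sup>2"
      using y by (intro power_mono) (auto simp: max_def)
    then have "64 * tail \<theta> * (max (y - 1/8) 0)\<^sup>2 \<le> 64 * tail \<theta> * (max (1/4 - 1/8) 0)\<^sup>2"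
      using tail_pos by (intro mult_left_mono) auto
    moreover have "\<alpha> * y < \<alpha> * (1/4)" using y pos by simp
    ultimately have "cdf (demand \<theta>) y < cdf (demand \<theta>) (1/4)"
      using y by (simp only: cdf_demand atLeastAtMost_iff) (simp add: cdf_demand)
    then show "cdf (demand \<theta>) x < 1" using mono[OF y(3)] one by linarith
  qed
qed

lemma Dbar_demand: "Dbar (demand \<theta>) = 1/4"
proof -
  have "{x. cdf (demand \<theta>) x < 1} = {..<1/4}"
    by (auto simp: cdf_demand_less_1_iff)
  then show ?thesis by (simp add: Dbar_def)
qed

lemma demand_in_class: "demand \<theta> \<in> demand_class \<alpha>"
proof -
  have "AE x in demand \<theta>. x \<in> {..<0} \<longleftrightarrow> x \<in> {}"
    using AE_demand[of \<theta>] by eventually_elim auto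
  then have "emeasure (demand \<theta>) {..<0} = emeasure (demand \<theta>) {}"
    by (rule emeasure_eq_AE) auto
  then have "measure (demand \<theta>) {..<0} = 0"
    by (simp add: measure_def)
  moreover have "\<exists>D. (cdf (demand \<theta>) has_real_derivative D) (at x within {0..1/4}) \<and> \<alpha> \<le> D"
    if x: "x \<in> {0..1/4}" for x
  proof (rule exI[of _ "\<alpha> + 128 * tail \<theta> * max (x - 1/8) 0"], rule conjI)
    \<comment> \<open>The formula is differentiable on the whole line but equals \<open>cdf\<close>
      only on [0, 1/4]; this suffices for the derivative within that interval, one-sided at its
      ends.\<close>
    have "((\<lambda>z. atom \<theta> + \<alpha> * z + 64 * tail \<theta> * (max (z - 1/8) 0)\<^sup>2)
        has_real_derivative \<alpha> + 128 * tail \<theta> * max (x - 1/8) 0) (at x within {0..1/4})"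
      by (rule DERIV_subset[OF DERIV_affine_hinge subset_UNIV])
    then show "(cdf (demand \<theta>) has_real_derivative \<alpha> + 128 * tail \<theta> * max (x - 1/8) 0) (at x within {0..1/4})"
      by (rule has_field_derivative_transform_within[OF _ zero_less_one x]) (simp only: cdf_demand)
    show "\<alpha> \<le> \<alpha> + 128 * tail \<theta> * max (x - 1/8) 0" using tail_pos by simp
  qed
  ultimately show ?thesis
    using prob_space_demand
    by (auto simp: demand_class_def Dbar_demand cdf_demand_less_1_iff intro!: exI[of _ "1/4"])
qed

text \<open>On [0, 1/8] the distribution function is affine with slope \<alpha>, so quadratic growth
  applies. Orders above 1/8 cost at least as much as ordering 1/8, hence the truncation
  \<open>min x (1/8)\<close>.\<close>

lemma regret_demand_ge:
  assumes "0 < h" "0 < b" "b / (h + b) = \<rho>" "0 \<le> x"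
  shows "(h + b) * \<alpha> / 2 * (min x (1/8) - \<theta>)\<^sup>2
    \<le> exp_cost h b (demand \<theta>) x - opt_cost h b (demand \<theta>)"
proof -
  interpret prob_space "demand \<theta>" by (rule prob_space_demand)
  have int: "integrable (demand \<theta>) (\<lambda>d. d)"
    by (rule integrable_const_bound[where B = "1/4"]) (use AE_demand[of \<theta>] in auto)
  note M = prob_space_demand sets_demand[of \<theta>] int
  have "(h + b) * \<alpha> / 2 * (y - \<theta>)\<^sup>2 \<le> exp_cost h b (demand \<theta>) y - exp_cost h b (demand \<theta>) \<theta>"
    if y: "y \<in> {0..1/8}" for y
  proof (rule exp_cost_quadratic_growth[OF assms(1,2) M])
    fix z assume "z \<in> closed_segment \<theta> y"
    then have "z \<in> {0..1/8}"
      using y \<theta> by (auto simp: closed_segment_eq_real_ivl split: if_splits)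
    then show "\<alpha> * (z - \<theta>) * (y - \<theta>) \<le> (cdf (demand \<theta>) z - b / (h + b)) * (y - \<theta>)"
      by (simp add: cdf_demand_left assms(3))
  qed
  from this[of "min x (1/8)"]
  have "(h + b) * \<alpha> / 2 * (min x (1/8) - \<theta>)\<^sup>2
      \<le> exp_cost h b (demand \<theta>) (min x (1/8)) - exp_cost h b (demand \<theta>) \<theta>"
    using assms by simp
  moreover have "exp_cost h b (demand \<theta>) (min x (1/8)) \<le> exp_cost h b (demand \<theta>) x"
  proof (cases "x \<le> 1/8")
    case False
    \<comment> \<open>At 1/8 the critical ratio has been reached, so the subgradient there is
      nonnegative.\<close>
    have "\<rho> \<le> cdf (demand \<theta>) (1/8)"
      using \<theta> pos by (simp add: cdf_demand_left)
    then have "b \<le> (h + b) * cdf (demand \<theta>) (1/8)"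
      using assms(1,2) by (simp add: assms(3)[symmetric] field_simps)
    then have "0 \<le> ((h + b) * cdf (demand \<theta>) (1/8) - b) * (x - 1/8)"
      using False by simp
    then show ?thesis
      using exp_cost_subgradient[of h b "demand \<theta>" "1/8" x] assms M False by simp
  qed simp
  moreover have "opt_cost h b (demand \<theta>) \<le> exp_cost h b (demand \<theta>) \<theta>"
    unfolding opt_cost_def
  proof (rule cInf_lower)
    show "bdd_below (exp_cost h b (demand \<theta>) ` {0..})"
      using assms
      by (intro bdd_belowI2[where m = 0]) (auto simp: exp_cost_def nv_cost_def intro!: integral_nonneg_AE)
  qed (use \<theta> in auto)
  ultimately show ?thesis by linarith
qed

section \<open>Likelihood ratios within the family\<close>

lemma demand_eq_density:
  "demand \<theta>' = density (demand \<theta>) (\<lambda>x. ennreal (dens \<theta>' x / dens \<theta> x))"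
proof -
  have "ennreal (dens \<theta>' x) = ennreal (dens \<theta> x) * ennreal (dens \<theta>' x / dens \<theta> x)" for x
    using dens_pos[of x] by (simp add: ennreal_mult'[symmetric])
  then show ?thesis
    unfolding demand_def by (subst density_density_eq) auto
qed

text \<open>This is one plus a chi-square bound. Moving mass \<open>d\<close> from an atom of mass
  \<open>p\<close> to a tail of mass \<open>e\<close> contributes at most d^2/p + d^2/e, and
  \<open>p \<ge> \<rho> / 2\<close>, \<open>e \<ge> (1 - \<rho>) / 2\<close>.\<close>

lemma likelihood_ratio_second_moment:
  assumes \<theta>': "\<theta>' \<in> {0..1/8}"
  shows "(\<integral>\<^sup>+ x. ennreal ((dens \<theta>' x / dens \<theta> x)\<^sup>2) \<partial>demand \<theta>)
    \<le> ennreal (1 + 2 * (\<alpha> * (\<theta>' - \<theta>))\<^sup>2 / (\<rho> * (1 - \<rho>)))"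
proof -
  define p e p' e' d where defs: "p = atom \<theta>" "e = tail \<theta>" "p' = atom \<theta>'" "e' = tail \<theta>'" "d = \<alpha> * (\<theta>' - \<theta>)"
  have p: "p > 0" "\<rho> / 2 \<le> p" and e: "e > 0" "(1 - \<rho>) / 2 \<le> e"
    using atom_pos tail_pos atom_ge tail_ge by (auto simp: defs)
  have p': "p' = p - d" and e': "e' = e + d" and pe: "p + \<alpha> / 4 + e = 1"
    by (auto simp: defs atom_def tail_def algebra_simps)
  have "(\<integral>\<^sup>+ x. ennreal ((dens \<theta>' x)\<^sup>2 / dens \<theta> x) * indicator {0..1/4} x \<partial>lborel)
      \<le> (\<integral>\<^sup>+ x. ennreal (\<alpha> + 128 * (e'\<^sup>2 / e) * max (x - 1/8) 0) * indicator {0..1/4} x \<partial>lborel)"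
  proof (rule nn_integral_mono_AE)
    \<comment> \<open>Cauchy-Schwarz for the sum of the constant density and the hinge density: the
      square of the mixed density is at most the product of the two sums.\<close>
    have bound: "(dens \<theta>' x)\<^sup>2 / dens \<theta> x \<le> \<alpha> + 128 * (e'\<^sup>2 / e) * max (x - 1/8) 0" if "x > 0" for x
    proof -
      define y where "y = 128 * max (x - 1/8) 0"
      have y: "y \<ge> 0" by (simp add: y_def)
      define q where "q = e'\<^sup>2 / e"
      have "q * e = e'\<^sup>2" using e by (simp add: q_def)
      moreover have "(\<alpha> + q * y) * (\<alpha> + e * y) = \<alpha>\<^sup>2 + \<alpha> * y * (q + e) + (q * e) * y\<^sup>2"
        by (simp add: power2_eq_square algebra_simps)
      ultimately have "(\<alpha> + q * y) * (\<alpha> + e * y) - (\<alpha> + e' * y)\<^sup>2 = \<alpha> * y * (q + e - 2 * e')"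
        by (simp add: power2_eq_square algebra_simps)
      also have "q + e - 2 * e' = (e' - e)\<^sup>2 / e"
        using e by (simp add: q_def power2_eq_square field_simps)
      finally have "(\<alpha> + q * y) * (\<alpha> + e * y) - (\<alpha> + e' * y)\<^sup>2 = \<alpha> * y * ((e' - e)\<^sup>2 / e)" .
      moreover have "0 \<le> \<alpha> * y * ((e' - e)\<^sup>2 / e)" using e pos y by simp
      ultimately have "(\<alpha> + e' * y)\<^sup>2 \<le> (\<alpha> + e'\<^sup>2 / e * y) * (\<alpha> + e * y)"
        unfolding q_def by linarith
      moreover have "0 < \<alpha> + e * y" using e pos y by (intro add_pos_nonneg) auto
      ultimately have "(\<alpha> + e' * y)\<^sup>2 / (\<alpha> + e * y) \<le> \<alpha> + e'\<^sup>2 / e * y"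
        by (simp add: pos_divide_le_eq)
      then show ?thesis using that by (simp add: dens_def y_def defs mult_ac)
    qed
    show "AE x in lborel. ennreal ((dens \<theta>' x)\<^sup>2 / dens \<theta> x) * indicator {0..1/4} x
        \<le> ennreal (\<alpha> + 128 * (e'\<^sup>2 / e) * max (x - 1/8) 0) * indicator {0..1/4} x"
      using AE_lborel_singleton[of 0]
      by eventually_elim (auto simp: indicator_def simp del: times_divide_eq_right intro!: ennreal_leI bound)
  qed
  also have "\<dots> = ennreal (\<alpha> * (1/4) + 64 * (e'\<^sup>2 / e) * (max (1/4 - 1/8) 0)\<^sup>2)"
    by (rule nn_integral_affine_hinge) (use pos e in auto)
  also have "\<dots> = ennreal (\<alpha> / 4 + e'\<^sup>2 / e)"
    by (simp add: power2_eq_square)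
  finally have tail_part: "(\<integral>\<^sup>+ x. ennreal ((dens \<theta>' x)\<^sup>2 / dens \<theta> x) * indicator {0..1/4} x \<partial>lborel)
      \<le> ennreal (\<alpha> / 4 + e'\<^sup>2 / e)" .
  have "(\<integral>\<^sup>+ x. ennreal ((dens \<theta>' x / dens \<theta> x)\<^sup>2) \<partial>demand \<theta>)
      = (\<integral>\<^sup>+ x. ennreal (dens \<theta> x) * ennreal ((dens \<theta>' x / dens \<theta> x)\<^sup>2) \<partial>base_measure)"
    unfolding demand_def by (subst nn_integral_density) auto
  also have "\<dots> = (\<integral>\<^sup>+ x. ennreal ((dens \<theta>' x)\<^sup>2 / dens \<theta> x) \<partial>base_measure)"
    using dens_pos
    by (intro nn_integral_cong) (simp add: ennreal_mult'[symmetric] power2_eq_square less_imp_le less_imp_neq[THEN not_sym])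
  also have "\<dots> = ennreal (p'\<^sup>2 / p)
      + (\<integral>\<^sup>+ x. ennreal ((dens \<theta>' x)\<^sup>2 / dens \<theta> x) * indicator {0..1/4} x \<partial>lborel)"
    by (subst nn_integral_base_measure) (auto simp: dens_def defs)
  also have "\<dots> \<le> ennreal (p'\<^sup>2 / p) + ennreal (\<alpha> / 4 + e'\<^sup>2 / e)"
    by (intro add_left_mono tail_part)
  also have "\<dots> = ennreal (p'\<^sup>2 / p + (\<alpha> / 4 + e'\<^sup>2 / e))"
    using p e pos by (intro ennreal_plus[symmetric]) auto
  also have "\<dots> \<le> ennreal (1 + 2 * d\<^sup>2 / (\<rho> * (1 - \<rho>)))"
  proof (rule ennreal_leI)
    \<comment> \<open>The terms linear in \<open>d\<close> cancel because the mass leaving the atom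
      enters the tail.\<close>
    have "p'\<^sup>2 / p + (\<alpha> / 4 + e'\<^sup>2 / e) = (p - 2 * d + d\<^sup>2 / p) + (\<alpha> / 4 + (e + 2 * d + d\<^sup>2 / e))"
    proof -
      have "p'\<^sup>2 / p = p - 2 * d + d\<^sup>2 / p"
        using p(1) unfolding p' by (simp add: power2_eq_square field_simps)
      moreover have "e'\<^sup>2 / e = e + 2 * d + d\<^sup>2 / e"
        using e(1) unfolding e' by (simp add: power2_eq_square field_simps)
      ultimately show ?thesis by simp
    qed
    also have "\<dots> = 1 + (d\<^sup>2 / p + d\<^sup>2 / e)"
      using pe by simp
    also have "\<dots> \<le> 1 + (d\<^sup>2 / (\<rho> / 2) + d\<^sup>2 / ((1 - \<rho>) / 2))"
      using p e rho by (intro add_left_mono add_mono divide_left_mono) auto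
    also have "\<dots> = 1 + 2 * d\<^sup>2 / (\<rho> * (1 - \<rho>))"
      using rho by (simp add: field_simps)
    finally show "p'\<^sup>2 / p + (\<alpha> / 4 + e'\<^sup>2 / e) \<le> 1 + 2 * d\<^sup>2 / (\<rho> * (1 - \<rho>))" .
  qed
  finally show ?thesis by (simp add: defs)
qed

end

end

section \<open>Average risk over a grid of parameters\<close>

context demand_family
begin

text \<open>The summand of \<open>regret\<close> for period \<open>t\<close>, as a function of the
  parameter so that it can be averaged over a grid.\<close>

definition risk :: "real \<Rightarrow> real \<Rightarrow> 'u measure \<Rightarrow> (nat \<Rightarrow> 'u \<Rightarrow> (nat \<Rightarrow> real) \<Rightarrow> real) \<Rightarrow> nat \<Rightarrow> real \<Rightarrow> ennreal"
  where "risk h b R pol t \<theta> = (\<integral>\<^sup>+ ud. ennreal (exp_cost h b (demand \<theta>) (pol t (fst ud) (snd ud))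
    - opt_cost h b (demand \<theta>)) \<partial>(R \<Otimes>\<^sub>M PiM {..<t} (\<lambda>_. demand \<theta>)))"

text \<open>No order is close to both optima, and the closeness condition bounds the second moment
  of the likelihood ratio of \<open>t\<close> samples by (1 + \<epsilon>)^t \<le> exp (t \<epsilon>)
  \<le> exp (1/2), so the two laws cannot be told apart reliably.\<close>

lemma two_point_risk:
  assumes hb: "0 < h" "0 < b" "b / (h + b) = \<rho>"
    and adm: "admissible R pol"
    and \<theta>: "\<theta> \<in> {0..1/8}" "\<theta>' \<in> {0..1/8}"
    and close: "real t * (4 * (\<alpha> * (\<theta>' - \<theta>))\<^sup>2) \<le> \<rho> * (1 - \<rho>)"
  shows "ennreal (29/200 * ((h + b) * \<alpha> * (\<theta>' - \<theta>)\<^sup>2)) \<le> risk h b R pol t \<theta> + risk h b R pol t \<theta>'"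
proof -
  define K where "K = (h + b) * \<alpha> / 2"
  have K: "0 < K" using hb pos by (simp add: K_def)
  define c where "c = K / 2 * (\<theta>' - \<theta>)\<^sup>2"
  have c: "0 \<le> c" using K by (simp add: c_def)
  define \<epsilon> where "\<epsilon> = 2 * (\<alpha> * (\<theta>' - \<theta>))\<^sup>2 / (\<rho> * (1 - \<rho>))"
  have V: "0 < \<rho> * (1 - \<rho>)" using rho by simp
  have \<epsilon>: "0 \<le> \<epsilon>" using V by (simp add: \<epsilon>_def)
  have "real t * \<epsilon> \<le> 1/2"
    using close V by (simp add: \<epsilon>_def field_simps)
  have R: "prob_space R" using adm by (simp add: admissible_def)
  have pol [measurable]: "(\<lambda>ud. pol t (fst ud) (snd ud)) \<in> borel_measurable (R \<Otimes>\<^sub>M PiM {..<t} (\<lambda>_. demand \<theta>))"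
    for \<theta>
  proof -
    have "(\<lambda>(u, d). pol t u d) \<in> borel_measurable (R \<Otimes>\<^sub>M PiM {..<t} (\<lambda>_. borel))"
      using adm by (simp add: admissible_def)
    moreover have "sets (R \<Otimes>\<^sub>M PiM {..<t} (\<lambda>_. borel)) = sets (R \<Otimes>\<^sub>M PiM {..<t} (\<lambda>_. demand \<theta>))"
      by (intro sets_pair_measure_cong sets_PiM_cong refl) auto
    ultimately show ?thesis
      by (simp add: split_beta' cong: measurable_cong_sets)
  qed
  define v where "v \<theta> ud = K * (min (pol t (fst ud) (snd ud)) (1/8) - \<theta>)\<^sup>2" for \<theta> ud
  have v_meas [measurable]: "v \<theta>' \<in> borel_measurable (R \<Otimes>\<^sub>M PiM {..<t} (\<lambda>_. demand \<theta>))" for \<theta> \<theta>'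
    unfolding v_def by measurable
  have risk: "(\<integral>\<^sup>+ ud. ennreal (v \<theta> ud) \<partial>(R \<Otimes>\<^sub>M PiM {..<t} (\<lambda>_. demand \<theta>))) \<le> risk h b R pol t \<theta>"
    if "\<theta> \<in> {0..1/8}" for \<theta>
    unfolding risk_def v_def K_def using adm
    by (intro nn_integral_mono ennreal_leI regret_demand_ge that hb) (auto simp: admissible_def)
  have sep: "c \<le> v \<theta> ud + v \<theta>' ud" for ud
  proof -
    define x where "x = min (pol t (fst ud) (snd ud)) (1/8)"
    \<comment> \<open>Parallelogram identity; equality holds when \<open>x\<close> is the midpoint
      of the two parameters.\<close>
    have "(\<theta>' - \<theta>)\<^sup>2 \<le> (\<theta>' - \<theta>)\<^sup>2 + (2 * x - \<theta> - \<theta>')\<^sup>2" by simp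
    also have "\<dots> = 2 * ((x - \<theta>)\<^sup>2 + (x - \<theta>')\<^sup>2)"
      by (simp add: power2_eq_square algebra_simps)
    finally have "(\<theta>' - \<theta>)\<^sup>2 / 2 \<le> (x - \<theta>)\<^sup>2 + (x - \<theta>')\<^sup>2" by simp
    from mult_left_mono[OF this, of K] show ?thesis
      using K by (simp add: c_def v_def x_def distrib_left)
  qed
  have "(1 + \<epsilon>) ^ t \<le> exp \<epsilon> ^ t"
    using \<epsilon> exp_ge_add_one_self[of \<epsilon>] by (intro power_mono) auto
  also have "\<dots> = exp (real t * \<epsilon>)" by (simp add: exp_of_nat_mult)
  also have "\<dots> \<le> exp (1/2)" using \<open>real t * \<epsilon> \<le> 1/2\<close> by simp
  also have "\<dots> \<le> 168/100"
  proof (rule power2_le_imp_le)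
    show "(exp (1/2))\<^sup>2 \<le> (168/100 :: real)\<^sup>2"
      using e_less_272 by (simp add: power2_eq_square exp_add[symmetric])
  qed simp
  finally have pow: "(1 + \<epsilon>) ^ t \<le> 168/100" .
  \<comment> \<open>0.58 is 1 - 1.68/4, and \<open>c\<close> equals a quarter of (h + b) \<alpha>
    times the squared distance, whence 29/200 = 0.58/4.\<close>
  have "29/200 * ((h + b) * \<alpha> * (\<theta>' - \<theta>)\<^sup>2) = c * (58/100)"
    by (simp add: c_def K_def)
  also have "\<dots> \<le> c * (1 - (1 + \<epsilon>) ^ t / 4)"
    using pow c by (intro mult_left_mono) auto
  finally have "ennreal (29/200 * ((h + b) * \<alpha> * (\<theta>' - \<theta>)\<^sup>2)) \<le> ennreal (c * (1 - (1 + \<epsilon>) ^ t / 4))"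
    by (rule ennreal_leI)
  also have "\<dots> \<le> (\<integral>\<^sup>+ ud. ennreal (v \<theta> ud) \<partial>(R \<Otimes>\<^sub>M PiM {..<t} (\<lambda>_. demand \<theta>)))
      + (\<integral>\<^sup>+ ud. ennreal (v \<theta>' ud) \<partial>(R \<Otimes>\<^sub>M PiM {..<t} (\<lambda>_. density (demand \<theta>)
          (\<lambda>x. ennreal (dens \<theta>' x / dens \<theta> x)))))"
  proof (rule two_point_bound_samples[OF R prob_space_demand[OF \<theta>(1)]])
    show "prob_space (density (demand \<theta>) (\<lambda>x. ennreal (dens \<theta>' x / dens \<theta> x)))"
      using prob_space_demand[OF \<theta>(2)] demand_eq_density[OF \<theta>(1), of \<theta>'] by simp
    show "(\<integral>\<^sup>+ x. ennreal ((dens \<theta>' x / dens \<theta> x)\<^sup>2) \<partial>demand \<theta>) \<le> ennreal (1 + \<epsilon>)"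
      unfolding \<epsilon>_def by (rule likelihood_ratio_second_moment[OF \<theta>])
    show "0 \<le> dens \<theta>' x / dens \<theta> x" for x
      using dens_pos[OF \<theta>(1), of x] dens_pos[OF \<theta>(2), of x] by simp
    show "(\<lambda>x. dens \<theta>' x / dens \<theta> x) \<in> borel_measurable (demand \<theta>)" by measurable
  qed (use K c \<epsilon> sep v_meas in \<open>auto simp: v_def\<close>)
  also have "\<dots> \<le> risk h b R pol t \<theta> + risk h b R pol t \<theta>'"
    unfolding demand_eq_density[OF \<theta>(1), of \<theta>', symmetric]
    by (intro add_mono risk \<theta>)
  finally show ?thesis .
qed

text \<open>Averaging over the grid \<open>i / (8 * N)\<close>, \<open>i < N\<close>: each point lies in at most two of the pairs
  \<open>(i, i + k)\<close>, and the shift \<open>k\<close> may depend on \<open>t\<close> while the grid does not.\<close>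
lemma grid_risk:
  assumes hb: "0 < h" "0 < b" "b / (h + b) = \<rho>"
    and adm: "admissible R pol" and k: "k \<le> N" "0 < N"
    and close: "real t * (4 * (\<alpha> * (real k / (8 * real N)))\<^sup>2) \<le> \<rho> * (1 - \<rho>)"
  shows "ennreal (29/400 * real (N - k) * ((h + b) * \<alpha> * (real k / (8 * real N))\<^sup>2))
    \<le> (\<Sum>i<N. risk h b R pol t (real i / (8 * real N)))"
proof -
  let ?r = "\<lambda>i. risk h b R pol t (real i / (8 * real N))"
  define a where "a = (h + b) * \<alpha> * (real k / (8 * real N))\<^sup>2"
  have a: "0 \<le> a" using hb pos by (simp add: a_def)
  have pair: "ennreal (29/200 * a) \<le> ?r i + ?r (i + k)" if "i < N - k" for i
  proof -
    have diff: "real (i + k) / (8 * real N) - real i / (8 * real N) = real k / (8 * real N)"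
      by (simp add: diff_divide_distrib[symmetric])
    show ?thesis
      using two_point_risk[OF hb adm, of "real i / (8 * real N)" "real (i + k) / (8 * real N)" t] that k close
      unfolding diff a_def by (simp add: field_simps)
  qed
  have "ennreal (2 * (29/400 * real (N - k) * a)) = (\<Sum>i<N - k. ennreal (29/200 * a))"
    using a by (simp add: ennreal_mult''[symmetric] ennreal_of_nat_eq_real_of_nat mult_ac)
  also have "\<dots> \<le> (\<Sum>i<N - k. ?r i + ?r (i + k))"
    by (intro sum_mono pair) auto
  also have "\<dots> = (\<Sum>i<N - k. ?r i) + (\<Sum>i\<in>{k..<N}. ?r i)"
    using sum.shift_bounds_nat_ivl[of ?r 0 k "N - k"] k by (simp add: sum.distrib atLeast0LessThan)
  also have "\<dots> \<le> (\<Sum>i<N. ?r i) + (\<Sum>i<N. ?r i)"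
    by (intro add_mono sum_mono2) auto
  also have "\<dots> = 2 * (\<Sum>i<N. ?r i)" by (simp add: mult_2)
  also have "ennreal (2 * (29/400 * real (N - k) * a)) = 2 * ennreal (29/400 * real (N - k) * a)"
    using a by (subst ennreal_mult) auto
  finally have "2 * ennreal (29/400 * real (N - k) * a) \<le> 2 * (\<Sum>i<N. ?r i)" .
  then show ?thesis
    by (simp add: a_def ennreal_mult_le_mult_iff)
qed

end

section \<open>Summation of the per-period bounds over time\<close>

lemma ln_div_le_sum_inverse:
  assumes "0 < m" "m \<le> n"
  shows "ln (real (Suc n) / real m) \<le> (\<Sum>t=m..n. 1 / real t)"
  using assms(2)
proof (induction n rule: dec_induct)
  case base
  have "ln (1 + 1 / real m) \<le> 1 / real m" by (rule ln_add_one_self_le_self) simp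
  then show ?case using assms(1) by (simp add: add_divide_distrib add.commute)
next
  case (step n)
  \<comment> \<open>The logarithm telescopes: passing to \<open>Suc n\<close> multiplies its
    argument by 1 + 1/(n + 1).\<close>
  have "real (Suc n) * (1 + 1 / real (Suc n)) = real (Suc (Suc n))"
    by (subst distrib_left) simp
  then have "real (Suc (Suc n)) / real m = real (Suc n) / real m * (1 + 1 / real (Suc n))"
    by (simp only: times_divide_eq_left)
  then have "ln (real (Suc (Suc n)) / real m) = ln (real (Suc n) / real m) + ln (1 + 1 / real (Suc n))"
    using assms(1) by (simp only:) (rule ln_mult_pos, auto intro: add_pos_pos)
  also have "ln (1 + 1 / real (Suc n)) \<le> 1 / real (Suc n)" by (rule ln_add_one_self_le_self) simp
  finally show ?case using step by simp
qed

text \<open>The distance \<open>\<tau>\<close> is the largest one allowed by the closeness condition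
  with \<open>W\<close> in place of \<rho> (1 - \<rho>); \<open>k\<close> rounds it down to the
  grid. The condition on \<open>t\<close> gives \<open>8 * \<tau> \<le> 42/100\<close>, so at least
  58% of the grid points start a pair; the condition on \<open>N\<close> gives
  \<open>10 \<le> 8 * real N * \<tau>\<close>, so rounding loses at most a tenth of the
  distance.\<close>

lemma (in demand_family) grid_risk_rate:
  assumes hb: "0 < h" "0 < b" "b / (h + b) = \<rho>" and adm: "admissible R pol"
    and W: "0 < W" "W \<le> \<rho> * (1 - \<rho>)" "W \<le> 1/100"
    and t: "15/16 \<le> \<alpha>\<^sup>2 * real t"
    and N: "0 < N" "5 / 4 * (2 * \<alpha>) \<le> real N * sqrt (W / real t)"
  shows "ennreal (real N * ((h + b) * W / (144 * \<alpha>)) * (1 / real t))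
    \<le> (\<Sum>i<N. risk h b R pol t (real i / (8 * real N)))"
proof -
  have t0: "0 < t" using t by (intro gr0I) auto
  define \<tau> where "\<tau> = sqrt (W / real t) / (2 * \<alpha>)"
  have \<tau>: "0 < \<tau>" using W t0 pos by (simp add: \<tau>_def)
  have sq: "\<tau>\<^sup>2 = W / (4 * (\<alpha>\<^sup>2 * real t))"
    using W t0 by (simp add: \<tau>_def power_divide power_mult_distrib)
  have "\<tau>\<^sup>2 \<le> (1/100) / (4 * (15/16))"
    unfolding sq using W t by (intro frac_le) auto
  also have "64 * \<dots> \<le> (42/100)\<^sup>2" by (simp add: power2_eq_square)
  finally have "(8 * \<tau>)\<^sup>2 \<le> (42/100)\<^sup>2" by (simp add: power_mult_distrib)
  then have \<tau>_le: "8 * \<tau> \<le> 42/100" by (rule power2_le_imp_le) simp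
  define k where "k = nat \<lfloor>8 * real N * \<tau>\<rfloor>"
  have big: "10 \<le> 8 * real N * \<tau>"
    using N(2) pos by (simp add: \<tau>_def field_simps)
  have k_le: "real k \<le> 8 * real N * \<tau>" and k_gt: "8 * real N * \<tau> - 1 < real k"
    using big unfolding k_def by linarith+
  define \<eta> where "\<eta> = real k / (8 * real N)"
  have \<eta>: "\<eta> \<le> \<tau>" "0 \<le> \<eta>" using k_le N(1) by (auto simp: \<eta>_def field_simps)
  have "9/10 * (8 * real N * \<tau>) \<le> real k" using k_gt big by linarith
  then have "9/10 * \<tau> \<le> \<eta>" using N(1) by (simp add: \<eta>_def field_simps)
  then have \<eta>_sq: "81/100 * \<tau>\<^sup>2 \<le> \<eta>\<^sup>2"
    using power_mono[of "9/10 * \<tau>" \<eta> 2] \<tau> by (simp add: power_mult_distrib power2_eq_square)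
  have "real k \<le> real N * (8 * \<tau>)" using k_le by (simp add: mult_ac)
  also have "\<dots> \<le> real N * (42/100)" using \<tau>_le by (intro mult_left_mono) auto
  finally have kN: "real k \<le> 42/100 * real N" by simp
  then have "k \<le> N" by linarith
  have Nk: "58/100 * real N \<le> real (N - k)" using kN \<open>k \<le> N\<close> by simp
  have close: "real t * (4 * (\<alpha> * \<eta>)\<^sup>2) \<le> \<rho> * (1 - \<rho>)"
  proof -
    have "\<eta>\<^sup>2 \<le> \<tau>\<^sup>2" using \<eta> by (intro power_mono) auto
    then have "4 * (\<alpha>\<^sup>2 * real t) * \<eta>\<^sup>2 \<le> 4 * (\<alpha>\<^sup>2 * real t) * \<tau>\<^sup>2"
      by (intro mult_left_mono) auto
    also have "\<dots> = W" using t0 pos by (simp add: sq)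
    finally show ?thesis using W by (simp add: power_mult_distrib mult_ac)
  qed
  \<comment> \<open>The loss factors are 0.58 for the number of pairs and 0.81 for the squared
    rounding; with 29/400 their product exceeds 4/144.\<close>
  have "real N * ((h + b) * W / (144 * \<alpha>)) * (1 / real t)
      = 4 / 144 * (real N * ((h + b) * \<alpha> * \<tau>\<^sup>2))"
    using pos t0 unfolding sq by (simp add: power2_eq_square)
  also have "\<dots> \<le> 29/400 * (58/100) * (81/100) * (real N * ((h + b) * \<alpha> * \<tau>\<^sup>2))"
    using hb pos by (intro mult_right_mono) auto
  also have "\<dots> = 29/400 * (58/100 * real N) * ((h + b) * \<alpha> * (81/100 * \<tau>\<^sup>2))"
    by simp
  also have "\<dots> \<le> 29/400 * real (N - k) * ((h + b) * \<alpha> * \<eta>\<^sup>2)"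
    using hb pos Nk \<eta>_sq by (intro mult_mono mult_nonneg_nonneg) auto
  finally have "ennreal (real N * ((h + b) * W / (144 * \<alpha>)) * (1 / real t))
      \<le> ennreal (29/400 * real (N - k) * ((h + b) * \<alpha> * \<eta>\<^sup>2))"
    by (rule ennreal_leI)
  also have "\<dots> \<le> (\<Sum>i<N. risk h b R pol t (real i / (8 * real N)))"
    using grid_risk[OF hb adm \<open>k \<le> N\<close> N(1), of t] close by (simp add: \<eta>_def)
  finally show ?thesis .
qed

theorem theorem2:
  fixes h b \<alpha> :: real and T :: nat
  assumes "0 < h" "0 < b" "0 < \<alpha>"
    and "\<alpha> \<le> min (1/2) (min (2 * (b / (h + b))) (2 * (1 - b / (h + b))))"
    and "real T \<ge> max (1 / \<alpha> ^ 3) 64"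
  shows "(INF Rp \<in> {(R :: 'u measure, pol). admissible R pol}.
            SUP M \<in> demand_class \<alpha>. regret h b M (fst Rp) (snd Rp) T)
         \<ge> ennreal (min ((b / (h + b)) * (1 - b / (h + b)) / (4 * pi^2)) (1 / (400 * pi^2))
                     * (h + b) / 12 * ln (real T) / \<alpha>)"
proof (rule INF_greatest)
  fix Rp :: "'u measure \<times> (nat \<Rightarrow> 'u \<Rightarrow> (nat \<Rightarrow> real) \<Rightarrow> real)"
  assume "Rp \<in> {(R, pol). admissible R pol}"
  then obtain R pol where Rp: "Rp = (R, pol)" and adm: "admissible R pol" by auto
  define \<rho> where "\<rho> = b / (h + b)"
  interpret demand_family \<alpha> \<rho>
    using assms by unfold_locales (auto simp: \<rho>_def)
  \<comment> \<open>This is the minimum in the claimed constant with the common factor 1/(4 pi^2)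
    taken out.\<close>
  define W where "W = min (\<rho> * (1 - \<rho>)) (1/100)"
  have W: "0 < W" "W \<le> \<rho> * (1 - \<rho>)" "W \<le> 1/100"
    using rho by (auto simp: W_def)
  define S where "S = (SUP M \<in> demand_class \<alpha>. regret h b M R pol T)"
  \<comment> \<open>The two lower bounds on \<open>T\<close> become \<open>4 \<le> s\<close> and
    \<open>1 \<le> \<alpha> * s\<close>.\<close>
  define s where "s = root 3 (real T)"
  have s3: "s ^ 3 = real T" by (simp add: s_def)
  have s4: "4 \<le> s"
    by (rule power_le_imp_le_base[of _ 2]) (use s3 assms in \<open>auto simp: numeral_3_eq_3 s_def\<close>)
  have s\<alpha>: "1 \<le> \<alpha> * s"
  proof (rule power_le_imp_le_base[of _ 2])
    show "1 ^ Suc 2 \<le> (\<alpha> * s) ^ Suc 2"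
      using assms(3,5) s3 by (simp add: power_mult_distrib numeral_3_eq_3[symmetric] field_simps del: power_Suc)
  qed (use s4 assms in auto)
  \<comment> \<open>The first period used is about T^(2/3). As \<open>s\<^sup>2\<close> is at least
    16, rounding down costs at most the fraction 1/16.\<close>
  define m where "m = nat \<lfloor>s\<^sup>2\<rfloor>"
  have s16: "16 \<le> s\<^sup>2" using power_mono[OF s4, of 2] by simp
  have m_le: "real m \<le> s\<^sup>2" and m_ge: "15/16 * s\<^sup>2 \<le> real m"
    using s16 unfolding m_def by linarith+
  have m0: "0 < m" using m_ge s16 by (intro gr0I) auto
  have "s\<^sup>2 * 1 \<le> s\<^sup>2 * s" using s4 by (intro mult_left_mono) auto
  then have mT: "m \<le> T" using m_le s3 by (simp add: power2_eq_square power3_eq_cube)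
  have t: "15/16 \<le> \<alpha>\<^sup>2 * real t" if "m \<le> t" for t
  proof -
    have "1 \<le> (\<alpha> * s)\<^sup>2" using s\<alpha> by simp
    then have "15/16 \<le> \<alpha>\<^sup>2 * (15/16 * s\<^sup>2)" by (simp add: power_mult_distrib)
    also have "\<dots> \<le> \<alpha>\<^sup>2 * real t" using m_ge that by (intro mult_left_mono) auto
    finally show ?thesis .
  qed
  \<comment> \<open>The grid must not depend on the period. Its fineness is dictated by
    \<open>t = T\<close>, where the admissible distance is smallest.\<close>
  obtain N where N: "5 / 4 * (2 * \<alpha>) / sqrt (W / real T) < real N"
    using reals_Archimedean2 by blast
  have sqrtT: "0 < sqrt (W / real T)" using W m0 mT by simp
  have N0: "0 < N"
    using N sqrtT pos by (intro gr0I) (use W in \<open>auto simp: divide_less_0_iff not_less\<close>)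
  define Y where "Y = (h + b) * W / (144 * \<alpha>)"
  have Y: "0 < Y" using W assms by (simp add: Y_def)
  have rate: "ennreal (real N * Y * (1 / real t)) \<le> (\<Sum>i<N. risk h b R pol t (real i / (8 * real N)))"
    if "t \<in> {m..T}" for t
    unfolding Y_def
  proof (rule grid_risk_rate[OF assms(1,2) \<rho>_def[symmetric] adm W t N0])
    have "5 / 4 * (2 * \<alpha>) \<le> real N * sqrt (W / real T)"
      using N sqrtT by (simp add: pos_divide_less_eq)
    also have "\<dots> \<le> real N * sqrt (W / real t)"
      using that m0 W by (intro mult_left_mono real_sqrt_le_mono divide_left_mono) auto
    finally show "5 / 4 * (2 * \<alpha>) \<le> real N * sqrt (W / real t)" .
  qed (use that in simp)
  \<comment> \<open>The range from \<open>m\<close> to \<open>T\<close> spans a ratio of at least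
    s^3 / s^2 = s, a third of \<open>T\<close> on the logarithmic scale.\<close>
  have "ln (real T) = 3 * ln s" using s4 by (simp add: s3[symmetric] ln_realpow)
  also have "s \<le> real (Suc T) / real m"
  proof -
    have "s * real m \<le> s * s\<^sup>2" using m_le s4 by (intro mult_left_mono) auto
    also have "\<dots> = real T" using s3 by (simp add: power2_eq_square power3_eq_cube)
    finally show ?thesis using m0 by (simp add: pos_le_divide_eq)
  qed
  then have "3 * ln s \<le> 3 * ln (real (Suc T) / real m)" using s4 by simp
  also have "\<dots> \<le> 3 * (\<Sum>t=m..T. 1 / real t)"
    using ln_div_le_sum_inverse[OF m0 mT] by simp
  finally have log: "ln (real T) / 3 \<le> (\<Sum>t=m..T. 1 / real t)" by simp
  have "of_nat N * ennreal (Y * (ln (real T) / 3)) = ennreal (real N * Y * (ln (real T) / 3))"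
    using Y m0 mT by (simp add: ennreal_of_nat_eq_real_of_nat ennreal_mult[symmetric] mult.assoc)
  also have "\<dots> \<le> ennreal (real N * Y * (\<Sum>t=m..T. 1 / real t))"
    using Y log by (intro ennreal_leI mult_left_mono) auto
  also have "\<dots> = (\<Sum>t=m..T. ennreal (real N * Y * (1 / real t)))"
    using Y by (subst sum_ennreal) (auto simp: sum_distrib_left)
  also have "\<dots> \<le> (\<Sum>t=m..T. \<Sum>i<N. risk h b R pol t (real i / (8 * real N)))"
    by (intro sum_mono rate)
  also have "\<dots> \<le> (\<Sum>t\<in>{1..T}. \<Sum>i<N. risk h b R pol t (real i / (8 * real N)))"
    using m0 by (intro sum_mono2) auto
  also have "\<dots> = (\<Sum>i<N. regret h b (demand (real i / (8 * real N))) R pol T)"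
    unfolding regret_def risk_def by (rule sum.swap)
  \<comment> \<open>The worst case dominates the average over the grid; the factor \<open>N\<close>
    is then cancelled.\<close>
  also have "\<dots> \<le> (\<Sum>i<N. S)"
  proof (rule sum_mono)
    fix i assume "i \<in> {..<N}"
    then have "real i / (8 * real N) \<in> {0..1/8}" by (simp add: field_simps)
    from demand_in_class[OF this]
    show "regret h b (demand (real i / (8 * real N))) R pol T \<le> S"
      unfolding S_def by (rule SUP_upper)
  qed
  finally have "of_nat N * ennreal (Y * (ln (real T) / 3)) \<le> of_nat N * S" by simp
  then have S: "ennreal (Y * (ln (real T) / 3)) \<le> S"
    using N0 by (simp add: ennreal_mult_le_mult_iff)
  \<comment> \<open>The claimed denominator 48 pi^2 is at least 48 * 9 = 3 * 144, the denominator
    obtained from \<open>Y\<close> and the factor 1/3 of the logarithm.\<close>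
  have pi: "9 \<le> pi\<^sup>2" using power_mono[of 3 pi 2] pi_gt3 by simp
  have "min (\<rho> * (1 - \<rho>) / (4 * pi\<^sup>2)) (1 / (400 * pi\<^sup>2)) = W / (4 * pi\<^sup>2)"
    by (simp add: W_def min_divide_distrib_right)
  then have "min (\<rho> * (1 - \<rho>) / (4 * pi\<^sup>2)) (1 / (400 * pi\<^sup>2)) * (h + b) / 12 * ln (real T) / \<alpha>
      = W * (h + b) * ln (real T) / \<alpha> / (48 * pi\<^sup>2)"
    by simp
  also have "\<dots> \<le> W * (h + b) * ln (real T) / \<alpha> / (48 * 9)"
    using W assms pi m0 mT by (intro divide_left_mono) auto
  also have "\<dots> = Y * (ln (real T) / 3)" by (simp add: Y_def mult_ac)
  finally show "ennreal (min (b / (h + b) * (1 - b / (h + b)) / (4 * pi\<^sup>2)) (1 / (400 * pi\<^sup>2))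
      * (h + b) / 12 * ln (real T) / \<alpha>)
    \<le> (SUP M \<in> demand_class \<alpha>. regret h b M (fst Rp) (snd Rp) T)"
    using S unfolding Rp S_def fst_conv snd_conv \<rho>_def
    by (meson ennreal_leI order_trans)
qed

end
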